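(* Assume that a Hamel basis of $\mathbb{R}$ over $\mathbb{Q}$ exists. Then $C(\tau_{\mathcal{H}})\not\subset\mathcal{U}$; in particular, there exists a $\tau_{\mathcal{H}}$-continuous function $f:\mathbb{R}\to\mathbb{R}$ which is not in $\mathcal{U}$.
   Context: The existence of a Hamel basis (a basis of $\mathbb{R}$ as a $\mathbb{Q}$-vector space) is assumed in addition to ZF. A function $H:\mathbb{R}\to\mathbb{R}$ is additive if $H(x+y)=H(x)+H(y)$ for all $x,y\in\mathbb{R}$; $\mathcal{H}$ is the set of all additive functions. $\tau_{\mathcal{H}}$ is the initial topology on $\mathbb{R}$ generated by $\mathcal{H}$, i.e. the smallest topology making every $H\in\mathcal{H}$ continuous as a map from $(\mathbb{R},\tau_{\mathcal{H}})$ to $\mathbb{R}$ with the usual topology. $C(\tau_{\mathcal{H}})$ is the set of $\tau_{\mathcal{H}}$-continuous functions, i.e. functions $f:\mathbb{R}\to\mathbb{R}$ continuous from $(\mathbb{R},\tau_{\mathcal{H}})$ to $\mathbb{R}$ with the usual topology. A function $g:\mathbb{R}\to\mathbb{R}$ is Darboux if for every $x<y$ with $g(x)\neq g(y)$ and every $\xi$ strictly between $g(x)$ and $g(y)$ there is $\eta\in(x,y)$ with $g(\eta)=\xi$. $\mathcal{U}$ is the class of functions $\mathbb{R}\to\mathbb{R}$ that are uniform limits of sequences of Darboux functions. *)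

theory Defs
  imports "HOL-Analysis.Analysis"
begin

interpretation rat_real: vector_space "\<lambda>(q::rat) (x::real). of_rat q * x"
  by unfold_locales (simp_all add: algebra_simps of_rat_add of_rat_mult)

definition hamel_basis :: "real set \<Rightarrow> bool" where
  "hamel_basis B \<longleftrightarrow> rat_real.independent B \<and> rat_real.span B = UNIV"

(* The qualified name is needed because HOL-Analysis has an unrelated constant of the
   same base name in Measure_Space. *)
definition additive_functions :: "(real \<Rightarrow> real) set" where
  "additive_functions = {H. Modules.additive H}"

definition tau_H :: "real topology" where
  "tau_H = topology_generated_by {H -` U | H U. H \<in> additive_functions \<and> open U}"

lemma topspace_tau_H: "topspace tau_H = UNIV"
proof -
  have "(\<lambda>x::real. x) -` UNIV \<in> {H -` U | H U. H \<in> additive_functions \<and> open U}"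
    by (auto simp: additive_functions_def Modules.additive_def intro!: exI[of _ "\<lambda>x::real. x"])
  then show ?thesis
    unfolding tau_H_def topology_generated_by_topspace by blast
qed

lemma continuous_map_tau_H:
  assumes "H \<in> additive_functions"
  shows "continuous_map tau_H euclidean H"
proof -
  have "openin tau_H (H -` U)" if "open U" for U
    unfolding tau_H_def using assms that by (intro topology_generated_by_Basis) blast
  then show ?thesis
    by (simp add: continuous_map topspace_tau_H vimage_def)
qed

lemma tau_H_smallest:
  assumes T: "topspace T = UNIV"
    and cont: "\<And>H. H \<in> additive_functions \<Longrightarrow> continuous_map T euclidean H"
    and "openin tau_H V"
  shows "openin T V"
proof -
  have basis: "openin T S" if "S \<in> {H -` U | H U. H \<in> additive_functions \<and> open U}" for S
  proof -
    from that obtain H U where "S = H -` U" "H \<in> additive_functions" "open U"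
      by blast
    with cont T show ?thesis
      by (simp add: continuous_map vimage_def)
  qed
  have "generate_topology_on {H -` U | H U. H \<in> additive_functions \<and> open U} V"
    using assms(3) unfolding tau_H_def by (rule openin_topology_generated_by)
  then show ?thesis
    by induction (use basis in auto)
qed

definition C_tau_H :: "(real \<Rightarrow> real) set" where
  "C_tau_H = {f. continuous_map tau_H euclidean f}"

definition darboux :: "(real \<Rightarrow> real) \<Rightarrow> bool" where
  "darboux g \<longleftrightarrow>
    (\<forall>x y. x < y \<and> g x \<noteq> g y \<longrightarrow>
      (\<forall>\<xi>. (g x < \<xi> \<and> \<xi> < g y) \<or> (g y < \<xi> \<and> \<xi> < g x) \<longrightarrow>
        (\<exists>\<eta>\<in>{x<..<y}. g \<eta> = \<xi>)))"

definition class_U :: "(real \<Rightarrow> real) set" where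
  "class_U = {f. \<exists>g :: nat \<Rightarrow> real \<Rightarrow> real.
     (\<forall>n. darboux (g n)) \<and> uniform_limit UNIV g f sequentially}"

end

theory Submission
  imports Defs
begin

text \<open>
  A nonzero additive function \<open>H\<close> with only rational values is the coefficient of a fixed element
  in the Hamel expansion. For an irrational \<open>c\<close>, the half-lines below and above \<open>c\<close> have
  complementary preimages under \<open>H\<close>, since \<open>H\<close> never hits \<open>c\<close>; both are \<open>\<tau>\<^sub>\<H>\<close>-open. So
  \<open>\<tau>\<^sub>\<H>\<close> has a proper nonempty clopen set, and its indicator function is \<open>\<tau>\<^sub>\<H>\<close>-continuous.
  On the other hand, a function with values exactly 0 and 1 is no uniform limit of Darboux
  functions: a Darboux function uniformly closer than \<open>1/2\<close> to it would have values on both sides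
  of \<open>1/2\<close>, hence the value \<open>1/2\<close> itself, which is too far from 0 and from 1.
\<close>

lemma ex_additive_rational_valued:
  assumes "hamel_basis B"
  obtains H b where "H \<in> additive_functions" "range H \<subseteq> \<rat>" "H b = 1"
proof -
  have indep: "rat_real.independent B" and span: "rat_real.span B = UNIV"
    using assms by (auto simp: hamel_basis_def)
  have "B \<noteq> {}"
  proof
    assume "B = {}"
    then have "(1::real) \<in> {0}"
      using span by auto
    then show False by simp
  qed
  then obtain b where b: "b \<in> B" by blast
  define H where "H x = real_of_rat (rat_real.representation B x b)" for x
  show thesis
  proof
    show "H \<in> additive_functions"
      by (simp add: additive_functions_def Modules.additive_def H_def of_rat_add
          rat_real.representation_add[OF indep] span)
    show "range H \<subseteq> \<rat>"
      by (auto simp: H_def)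
    show "H b = 1"
      by (simp add: H_def rat_real.representation_basis[OF indep b])
  qed
qed

lemma ex_irrational_between_0_1:
  obtains c :: real where "0 < c" "c < 1" "c \<notin> \<rat>"
proof -
  have "uncountable {0<..<1::real}"
    by (simp add: uncountable_open_interval)
  then have "\<not> {0<..<1::real} \<subseteq> \<rat>"
    using countable_rat countable_subset by blast
  then show thesis
    using that by (meson greaterThanLessThan_iff subsetI)
qed

lemma continuous_map_indicator_clopen:
  assumes "topspace T = UNIV" "openin T S" "openin T (- S)"
  shows "continuous_map T euclidean (indicator S :: 'a \<Rightarrow> real)"
proof -
  have "openin T {x. (indicator S x :: real) \<in> U}" for U
  proof -
    have "{x. (indicator S x :: real) \<in> U} =
        (if 1 \<in> U then S else {}) \<union> (if 0 \<in> U then - S else {})"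
      by (auto simp: indicator_def)
    then show ?thesis
      using assms by (simp only:) (intro openin_Un, simp_all)
  qed
  then show ?thesis
    by (simp add: continuous_map assms(1))
qed

lemma darboux_attains_intermediate:
  assumes "darboux g" "g x < \<xi>" "\<xi> < g y"
  shows "\<xi> \<in> range g"
proof -
  have "x < y \<or> y < x"
    using assms by (metis less_asym linorder_neqE)
  then show ?thesis
    using assms unfolding darboux_def by (metis less_trans less_irrefl rangeI)
qed

lemma indicator_notin_class_U:
  assumes "a \<notin> S" "b \<in> S"
  shows "indicator S \<notin> class_U"
proof
  assume "indicator S \<in> class_U"
  then obtain g where darb: "\<And>n. darboux (g n)"
    and lim: "uniform_limit UNIV g (indicator S) sequentially"
    by (auto simp: class_U_def)
  have "\<forall>\<^sub>F n in sequentially. \<forall>x\<in>UNIV. dist (g n x) (indicator S x) < 1/2"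
    using lim by (rule uniform_limitD) simp
  then obtain n where n: "\<bar>g n x - indicator S x\<bar> < 1/2" for x
    by (auto simp: eventually_sequentially dist_real_def)
  have "g n a < 1/2" "1/2 < g n b"
    using n[of a] n[of b] assms by (simp_all add: abs_if split: if_splits)
  then obtain z where "g n z = 1/2"
    using darboux_attains_intermediate[OF darb] by (metis rangeE)
  then show False
    using n[of z] by (cases "z \<in> S") auto
qed

theorem theorem6p1:
  assumes "\<exists>B. hamel_basis B"
  shows "\<not> C_tau_H \<subseteq> class_U \<and> (\<exists>f. continuous_map tau_H euclidean f \<and> f \<notin> class_U)"
proof -
  obtain H b where H: "H \<in> additive_functions" "range H \<subseteq> \<rat>" "H b = 1"
    using assms ex_additive_rational_valued by blast
  obtain c :: real where c: "0 < c" "c < 1" "c \<notin> \<rat>"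
    by (rule ex_irrational_between_0_1)
  define S where "S = H -` {c<..}"
  have preimage_open: "openin tau_H (H -` U)" if "open U" for U
    using continuous_map_tau_H[OF H(1)] that
    by (simp add: continuous_map topspace_tau_H vimage_def)
  have "H x \<noteq> c" for x
    using H(2) c(3) by auto
  then have "- S = H -` {..<c}"
    by (auto simp: S_def not_less order_le_less)
  then have "openin tau_H S" "openin tau_H (- S)"
    by (simp_all add: S_def preimage_open)
  then have cont: "continuous_map tau_H euclidean (indicator S :: real \<Rightarrow> real)"
    by (intro continuous_map_indicator_clopen topspace_tau_H)
  have "H 0 = 0"
    using H(1) by (simp add: additive_functions_def Modules.additive.zero)
  then have "0 \<notin> S" "b \<in> S"
    using c H(3) by (auto simp: S_def)
  then have "indicator S \<notin> class_U"
    by (rule indicator_notin_class_U)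
  with cont show ?thesis
    unfolding C_tau_H_def by blast
qed

end
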